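(* Let $N\ge1$, $1<p<\infty$ and $0<s<1$ satisfy $N>sp$, and let $\Omega\subset\mathbb{R}^N$ be a bounded open set. Then there exists a constant $C=C(N,s,p,\Omega)>0$ such that for every $u\in W^{s+\log,p}_0(\Omega)$, $$\|u\|^p_{L^{p_s^*}(\Omega)}\le C\iint_{\mathbb{R}^{2N}}|u(x)-u(y)|^p\,\mathbf{k}^{s+\log,+}_p(x-y)\,dx\,dy,$$ where $p_s^*=\frac{Np}{N-sp}$.
   Context: With $(a)_+=\max\{0,a\}$, $$\mathbf{k}^{s+\log,+}_p(z)=\frac{C(N,s,p)(-\ln|z|)_+}{|z|^{N+sp}},\quad z\in\mathbb{R}^N\setminus\{0\},$$ $$C(N,s,p)=\begin{cases}\dfrac{s\,p\,2^{2(s-1)}\,\Gamma\left(\frac{N+sp}{2}\right)}{\pi^{\frac{N-1}{2}}\,\Gamma(1-s)\,\Gamma\left(\frac{p+1}{2}\right)}, & s>\tfrac12,\\[8pt]\dfrac{s\,p\,2^{2s-1}\,\Gamma\left(\frac{N+sp}{2}\right)}{\pi^{\frac N2}\,\Gamma(1-s)}, & s\le\tfrac12.\end{cases}$$ $W^{s+\log,p}_0(\Omega)$ is the space of real-valued $u\in L^p(\mathbb{R}^N)$ with $u=0$ a.e. in $\mathbb{R}^N\setminus\Omega$ and $\iint_{\mathbb{R}^{2N}}|u(x)-u(y)|^p\,\mathbf{k}^{s+\log,+}_p(x-y)\,dx\,dy<\infty$. *)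

theory Defs
  imports "HOL-Analysis.Analysis"
begin

text \<open>
  The space R^N is an arbitrary Euclidean space \<^typ>\<open>'a\<close> with N = DIM('a), which is at least 1.
  Elements of Lebesgue and Sobolev-type spaces are represented by Lebesgue measurable functions
  rather than by classes modulo almost everywhere equality. Integrals of nonnegative functions
  take values in \<^typ>\<open>ennreal\<close>, so that no integrability is presupposed.
\<close>

text \<open>Real powers of extended nonnegative reals; used only for positive exponents.\<close>

definition ennpowr :: "ennreal \<Rightarrow> real \<Rightarrow> ennreal" where
  "ennpowr x a = (if x = \<infinity> then \<infinity> else ennreal (enn2real x powr a))"

definition Lp_norm :: "real \<Rightarrow> 'a::euclidean_space set \<Rightarrow> ('a \<Rightarrow> real) \<Rightarrow> ennreal" where
  "Lp_norm q A u = ennpowr (\<integral>\<^sup>+x\<in>A. ennreal (\<bar>u x\<bar> powr q) \<partial>lebesgue) (1 / q)"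

definition Lp_space :: "real \<Rightarrow> ('a::euclidean_space \<Rightarrow> real) set" where
  "Lp_space q = {u \<in> borel_measurable lebesgue. Lp_norm q UNIV u < \<infinity>}"

definition kernel_const :: "nat \<Rightarrow> real \<Rightarrow> real \<Rightarrow> real" where
  "kernel_const N s p =
    (if s > 1 / 2 then
       s * p * 2 powr (2 * (s - 1)) * Gamma ((real N + s * p) / 2)
         / (pi powr ((real N - 1) / 2) * Gamma (1 - s) * Gamma ((p + 1) / 2))
     else
       s * p * 2 powr (2 * s - 1) * Gamma ((real N + s * p) / 2)
         / (pi powr (real N / 2) * Gamma (1 - s)))"

text \<open>
  The kernel is only meaningful away from the origin; by the convention for division by zero it
  takes the value 0 there.
\<close>

definition log_kernel :: "real \<Rightarrow> real \<Rightarrow> 'a::euclidean_space \<Rightarrow> real" where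
  "log_kernel s p z =
    kernel_const DIM('a) s p * max 0 (- ln (norm z)) / norm z powr (real DIM('a) + s * p)"

definition log_energy :: "real \<Rightarrow> real \<Rightarrow> ('a::euclidean_space \<Rightarrow> real) \<Rightarrow> ennreal" where
  "log_energy s p u =
    (\<integral>\<^sup>+(x, y). ennreal (\<bar>u x - u y\<bar> powr p * log_kernel s p (x - y))
       \<partial>(lebesgue :: ('a \<times> 'a) measure))"

definition W_log_0 :: "real \<Rightarrow> real \<Rightarrow> 'a::euclidean_space set \<Rightarrow> ('a \<Rightarrow> real) set" where
  "W_log_0 s p \<Omega> =
    {u \<in> Lp_space p. (AE x in lebesgue. x \<notin> \<Omega> \<longrightarrow> u x = 0) \<and> log_energy s p u < \<infinity>}"

end

theory Submission
  imports Defs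
begin

text \<open>
  Write \<open>N\<close> for the dimension, \<open>\<sigma> = s p\<close>, \<open>q = N p / (N - \<sigma>)\<close>, and \<open>U\<close> for the integral of \<open>|v|\<^sup>q\<close>.

  Near the origin, for \<open>|z| < exp (-1)\<close>, the logarithm in the kernel is at least 1 in absolute value,
  so up to a constant the kernel dominates the Riesz kernel \<open>|z| powr -(N + \<sigma>)\<close> truncated to the
  ball of radius \<open>exp (-1)\<close>. It is therefore enough to prove the Sobolev inequality for a truncated
  fractional energy. Two facts yield it.

  First, if the truncation radius \<open>\<rho>\<close> is large compared with the measure \<open>V\<close> of the support, there
  is a direct pointwise proof (\<open>Sobolev_pointwise\<close>). Fix \<open>x\<close> with \<open>v x \<noteq> 0\<close>. The set where
  \<open>|v| > |v x| / 2\<close> has measure at most \<open>m = min (2\<^sup>q U / |v x|\<^sup>q) V\<close>, by Markov's inequality and the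
  bound on the support. In a ball around \<open>x\<close> of measure \<open>2 m\<close> at least half of the points lie outside
  that set, and there \<open>|v x - v y| \<ge> |v x| / 2\<close>. This bounds the inner energy integral at \<open>x\<close> from
  below by a constant times \<open>|v x|\<^sup>p m powr -(\<sigma> / N)\<close>, hence by a constant times
  \<open>|v x|\<^sup>q U powr -(\<sigma> / N)\<close>, since \<open>p + q \<sigma> / N = q\<close>. Integration over \<open>x\<close> gives
  \<open>U powr (1 - \<sigma> / N) \<le> C E\<close>, and \<open>1 - \<sigma> / N = p / q\<close>. Dividing by a power of \<open>U\<close> presupposes
  \<open>U < \<infinity>\<close>; truncating the values of \<open>v\<close> ensures this without increasing the energy, and the
  truncation is removed by monotone convergence (\<open>Sobolev_trunc\<close>).

  Second, doubling the truncation radius costs at most a constant factor in the energy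
  (\<open>trunc_energy_double\<close>): a translation by \<open>2 h\<close> is two translations by \<open>h\<close>. After finitely many
  doublings the radius \<open>exp (-1)\<close> becomes large enough for the first fact, and the number of
  doublings depends only on \<open>N\<close> and \<open>\<Omega>\<close>.
\<close>

section \<open>Nonlocal energies and the truncated Riesz kernel\<close>

definition trunc_kernel :: "real \<Rightarrow> real \<Rightarrow> 'a::euclidean_space \<Rightarrow> real" where
  "trunc_kernel \<sigma> \<rho> z = (if norm z < \<rho> then norm z powr - (real DIM('a) + \<sigma>) else 0)"

definition nonlocal_energy ::
    "real \<Rightarrow> ('a \<Rightarrow> real) \<Rightarrow> ('a::euclidean_space \<Rightarrow> real) \<Rightarrow> ennreal" where
  "nonlocal_energy p k v =
    (\<integral>\<^sup>+x. \<integral>\<^sup>+y. ennreal (\<bar>v x - v y\<bar> powr p * k (x - y)) \<partial>lborel \<partial>lborel)"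

lemma trunc_kernel_nonneg [simp]: "0 \<le> trunc_kernel \<sigma> \<rho> z"
  by (simp add: trunc_kernel_def)

lemma borel_measurable_trunc_kernel [measurable]:
  "trunc_kernel \<sigma> \<rho> \<in> borel_measurable borel"
  unfolding trunc_kernel_def by measurable

section \<open>Sobolev inequality with a large truncation radius\<close>

text \<open>
  Removing a set of measure \<open>m\<close> from the ball of measure \<open>2 m\<close> around \<open>x\<close> leaves a set of measure at
  least \<open>m\<close>; away from \<open>x\<close> the kernel there exceeds its value at the boundary. The radius
  of that ball is \<open>(2 m / \<omega>) powr (1 / N)\<close>.
\<close>

lemma trunc_kernel_integral_compl_ge:
  fixes x :: "'a::euclidean_space" and L :: "'a set" and \<sigma> \<rho> m :: real
  defines "N \<equiv> real DIM('a)" and "\<omega> \<equiv> unit_ball_vol (real DIM('a))"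
  assumes "0 < m" "0 < \<sigma>" and L [measurable]: "L \<in> sets borel" and "emeasure lborel L \<le> ennreal m"
    and "(2 * m / \<omega>) powr (1 / N) \<le> \<rho>"
  shows "ennreal ((\<omega> / 2) powr (1 + \<sigma> / N) * m powr - (\<sigma> / N))
    \<le> (\<integral>\<^sup>+y\<in>-L. ennreal (trunc_kernel \<sigma> \<rho> (x - y)) \<partial>lborel)"
proof -
  define r where "r = (2 * m / \<omega>) powr (1 / N)"
  have N: "N > 0" and \<omega>: "\<omega> > 0" by (simp_all add: N_def \<omega>_def)
  have r: "r > 0" using assms(3) \<omega> by (simp add: r_def)
  have "r ^ DIM('a) = r powr N" using r by (simp add: N_def powr_realpow)
  also have "\<dots> = 2 * m / \<omega>" using N \<omega> assms(3) by (simp add: r_def powr_powr)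
  finally have ball: "emeasure lborel (ball x r) = ennreal (2 * m)"
    using r \<omega> by (simp add: emeasure_ball flip: \<omega>_def)
  have "ennreal m = ennreal (2 * m) - ennreal m"
    using assms(3) by (subst ennreal_minus) auto
  also have "\<dots> \<le> emeasure lborel (ball x r) - emeasure lborel (ball x r \<inter> L)"
    unfolding ball
    by (intro ennreal_minus_mono order_refl order_trans[OF _ assms(6)] emeasure_mono) auto
  also have "\<dots> = emeasure lborel (ball x r - ball x r \<inter> L)"
  proof (rule emeasure_Diff[symmetric])
    have "emeasure lborel (ball x r \<inter> L) \<le> ennreal (2 * m)"
      unfolding ball[symmetric] by (rule emeasure_mono) auto
    then show "emeasure lborel (ball x r \<inter> L) \<noteq> \<infinity>"
      by (auto simp: top_unique)
  qed auto
  finally have m: "ennreal m \<le> emeasure lborel (ball x r - ball x r \<inter> L)" .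
  have "(\<omega> / 2) powr (1 + \<sigma> / N) * m powr - (\<sigma> / N) = r powr - (N + \<sigma>) * m"
  proof -
    have "r powr - (N + \<sigma>) = (2 * m / \<omega>) powr - (1 + \<sigma> / N)"
    proof -
      have "1 / N * - (N + \<sigma>) = - (1 + \<sigma> / N)" using N by (simp add: field_simps)
      then show ?thesis by (simp only: r_def powr_powr)
    qed
    also have "\<dots> = (\<omega> / 2) powr (1 + \<sigma> / N) * m powr - (1 + \<sigma> / N)"
    proof -
      have "(2 * m / \<omega>) powr - a = (\<omega> / 2) powr a * m powr - a" for a
        using \<omega> assms(3) by (simp add: powr_minus powr_divide powr_mult field_simps)
      then show ?thesis .
    qed
    also have "\<dots> * m = (\<omega> / 2) powr (1 + \<sigma> / N) * m powr - (\<sigma> / N)"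
      using assms(3) powr_add[of m 1 "- (1 + \<sigma> / N)"] by simp
    finally show ?thesis by simp
  qed
  then have "ennreal ((\<omega> / 2) powr (1 + \<sigma> / N) * m powr - (\<sigma> / N)) = ennreal (r powr - (N + \<sigma>)) * ennreal m"
    using assms(3) by (simp add: ennreal_mult)
  also have "\<dots> \<le> ennreal (r powr - (N + \<sigma>)) * emeasure lborel (ball x r - ball x r \<inter> L)"
    by (intro mult_left_mono m) auto
  also have "\<dots> = (\<integral>\<^sup>+y. ennreal (r powr - (N + \<sigma>)) * indicator (ball x r - ball x r \<inter> L) y \<partial>lborel)"
    by (rule nn_integral_cmult_indicator[symmetric]) auto
  also have "\<dots> \<le> (\<integral>\<^sup>+y\<in>-L. ennreal (trunc_kernel \<sigma> \<rho> (x - y)) \<partial>lborel)"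
    \<comment> \<open>At \<open>y = x\<close> the kernel has the value 0, because \<open>0 powr a = 0\<close>; so that point is left out.\<close>
  proof (intro nn_integral_mono_AE eventually_mono[OF AE_lborel_singleton[of x]])
    fix y assume "y \<noteq> x"
    show "ennreal (r powr - (N + \<sigma>)) * indicator (ball x r - ball x r \<inter> L) y
      \<le> ennreal (trunc_kernel \<sigma> \<rho> (x - y)) * indicator (-L) y"
    proof (cases "y \<in> ball x r - L")
      case True
      then have "norm (x - y) < r" "norm (x - y) > 0"
        using \<open>y \<noteq> x\<close> by (auto simp: dist_norm)
      moreover have "r \<le> \<rho>" using assms(7) by (simp add: r_def)
      ultimately show ?thesis using True N assms(4)
        by (auto simp: trunc_kernel_def N_def[symmetric] intro!: ennreal_leI powr_mono2')
    qed auto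
  qed
  finally show ?thesis .
qed

text \<open>
  The heart of the proof: on most of a suitable small ball around \<open>x\<close> the function is at most half as
  large as at \<open>x\<close>. Bounding the measure \<open>m\<close> of the exceptional set by \<open>V\<close> as well as by Markov's
  inequality keeps the radius of the ball below \<open>\<rho>\<close>, so the truncated kernel suffices.
\<close>

lemma Sobolev_pointwise:
  fixes v :: "'a::euclidean_space \<Rightarrow> real" and \<sigma> \<rho> q U V :: real
  defines "N \<equiv> real DIM('a)" and "\<omega> \<equiv> unit_ball_vol (real DIM('a))"
  assumes v [measurable]: "v \<in> borel_measurable borel"
    and "0 < \<sigma>" "\<sigma> < N" "0 < q" "0 < U" "0 < V"
    and U: "(\<integral>\<^sup>+y. ennreal (\<bar>v y\<bar> powr q) \<partial>lborel) = ennreal U"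
    and V: "emeasure lborel {y. v y \<noteq> 0} \<le> ennreal V"
    and \<rho>: "(2 * V / \<omega>) powr (1 / N) \<le> \<rho>"
  shows "ennreal ((\<omega> / 2) powr (1 + \<sigma> / N) / 2 powr q * \<bar>v x\<bar> powr q) \<le> ennreal (U powr (\<sigma> / N)) *
    (\<integral>\<^sup>+y. ennreal (\<bar>v x - v y\<bar> powr (q * (1 - \<sigma> / N)) * trunc_kernel \<sigma> \<rho> (x - y)) \<partial>lborel)"
proof (cases "v x = 0")
  case False
  define p where "p = q * (1 - \<sigma> / N)"
  define t where "t = \<bar>v x\<bar>"
  define L where "L = {y. t / 2 < \<bar>v y\<bar>}"
  define m\<^sub>0 where "m\<^sub>0 = 2 powr q * U / t powr q"
  define m where "m = min m\<^sub>0 V"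
  have N: "N > 0" and \<omega>: "\<omega> > 0" by (simp_all add: N_def \<omega>_def)
  have t: "t > 0" using False by (simp add: t_def)
  have p: "p > 0" using assms N by (simp add: p_def field_simps)
  have m0: "m\<^sub>0 > 0" and m: "m > 0" using assms t by (auto simp: m\<^sub>0_def m_def)
  have L [measurable]: "L \<in> sets borel" unfolding L_def by measurable
  have "emeasure lborel L \<le> ennreal m\<^sub>0"
  proof -
    have "emeasure lborel L = (\<integral>\<^sup>+y. indicator L y \<partial>lborel)" by simp
    also have "\<dots> \<le> (\<integral>\<^sup>+y. ennreal (2 powr q / t powr q) * ennreal (\<bar>v y\<bar> powr q) \<partial>lborel)"
    proof (intro nn_integral_mono)
      fix y
      have "1 \<le> 2 powr q / t powr q * \<bar>v y\<bar> powr q" if "t / 2 < \<bar>v y\<bar>"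
      proof -
        have "(t / 2) powr q \<le> \<bar>v y\<bar> powr q"
          using that t assms by (intro powr_mono2) auto
        then show ?thesis using t by (simp add: powr_divide field_simps)
      qed
      then show "indicator L y \<le> ennreal (2 powr q / t powr q) * ennreal (\<bar>v y\<bar> powr q)"
        by (auto simp: L_def indicator_def simp flip: ennreal_mult)
    qed
    also have "\<dots> = ennreal (2 powr q / t powr q) * ennreal U"
      by (simp add: nn_integral_cmult U)
    also have "\<dots> = ennreal m\<^sub>0" using assms by (simp add: m\<^sub>0_def flip: ennreal_mult)
    finally show ?thesis .
  qed
  moreover have "emeasure lborel L \<le> ennreal V"
    by (rule order_trans[OF emeasure_mono V]) (use t in \<open>auto simp: L_def\<close>)
  ultimately have Lm: "emeasure lborel L \<le> ennreal m"
    by (simp add: m_def min_def)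
  have "(2 * m / \<omega>) powr (1 / N) \<le> (2 * V / \<omega>) powr (1 / N)"
    using m N \<omega> by (intro powr_mono2 divide_right_mono) (auto simp: m_def)
  with \<rho> have r: "(2 * m / \<omega>) powr (1 / N) \<le> \<rho>" by simp
  let ?c = "(\<omega> / 2) powr (1 + \<sigma> / N)"
  have "?c / 2 powr q * t powr q = U powr (\<sigma> / N) * ((t / 2) powr p * (?c * m\<^sub>0 powr - (\<sigma> / N)))"
  proof -
    have "m\<^sub>0 powr - (\<sigma> / N) = t powr (q * (\<sigma> / N)) / (2 powr (q * (\<sigma> / N)) * U powr (\<sigma> / N))"
      using assms t by (simp add: m\<^sub>0_def powr_minus powr_divide powr_mult powr_powr field_simps)
    moreover have "t powr q = t powr p * t powr (q * (\<sigma> / N))"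
        "(2::real) powr q = 2 powr p * 2 powr (q * (\<sigma> / N))"
      by (simp_all add: p_def algebra_simps flip: powr_add)
    ultimately show ?thesis using assms(7) t by (simp add: powr_divide mult_ac)
  qed
  also have "\<dots> \<le> U powr (\<sigma> / N) * ((t / 2) powr p * (?c * m powr - (\<sigma> / N)))"
    using m assms(4) N by (intro mult_left_mono powr_mono2') (auto simp: m_def)
  finally have "ennreal (?c / 2 powr q * t powr q)
      \<le> ennreal (U powr (\<sigma> / N)) * (ennreal ((t / 2) powr p) * ennreal (?c * m powr - (\<sigma> / N)))"
    by (subst ennreal_mult[symmetric] | simp add: ennreal_leI)+
  also have "\<dots> \<le> ennreal (U powr (\<sigma> / N)) * (ennreal ((t / 2) powr p) *
      (\<integral>\<^sup>+y\<in>-L. ennreal (trunc_kernel \<sigma> \<rho> (x - y)) \<partial>lborel))"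
    using trunc_kernel_integral_compl_ge[OF m assms(4) L Lm, of \<rho> x] r
    by (intro mult_left_mono) (auto simp: N_def \<omega>_def)
  also have "(ennreal ((t / 2) powr p) * (\<integral>\<^sup>+y\<in>-L. ennreal (trunc_kernel \<sigma> \<rho> (x - y)) \<partial>lborel))
     = (\<integral>\<^sup>+y. ennreal ((t / 2) powr p) * (ennreal (trunc_kernel \<sigma> \<rho> (x - y)) * indicator (-L) y) \<partial>lborel)"
    by (rule nn_integral_cmult[symmetric]) measurable
  also have "\<dots> \<le> (\<integral>\<^sup>+y. ennreal (\<bar>v x - v y\<bar> powr p * trunc_kernel \<sigma> \<rho> (x - y)) \<partial>lborel)"
  proof (intro nn_integral_mono)
    fix y
    have "(t / 2) powr p \<le> \<bar>v x - v y\<bar> powr p" if "y \<notin> L"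
    proof (intro powr_mono2)
      have "\<bar>v y\<bar> \<le> t / 2" using that by (simp add: L_def)
      then show "t / 2 \<le> \<bar>v x - v y\<bar>" unfolding t_def by linarith
    qed (use t p in auto)
    then show "ennreal ((t / 2) powr p) * (ennreal (trunc_kernel \<sigma> \<rho> (x - y)) * indicator (-L) y)
       \<le> ennreal (\<bar>v x - v y\<bar> powr p * trunc_kernel \<sigma> \<rho> (x - y))"
      by (auto simp: indicator_def mult_right_mono ennreal_leI simp flip: ennreal_mult)
  qed
  finally show ?thesis by (auto simp: t_def p_def mult_left_mono)
qed simp

text \<open>Finiteness of the \<open>q\<close>-th power integral allows a power of it to be absorbed on the left.\<close>

lemma Sobolev_trunc_if_finite:
  fixes v :: "'a::euclidean_space \<Rightarrow> real" and \<sigma> \<rho> q U V :: real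
  defines "N \<equiv> real DIM('a)" and "\<omega> \<equiv> unit_ball_vol (real DIM('a))"
  assumes v [measurable]: "v \<in> borel_measurable borel"
    and "0 < \<sigma>" "\<sigma> < N" "0 < q" "0 \<le> U" "0 < V"
    and U: "(\<integral>\<^sup>+y. ennreal (\<bar>v y\<bar> powr q) \<partial>lborel) = ennreal U"
    and V: "emeasure lborel {y. v y \<noteq> 0} \<le> ennreal V"
    and \<rho>: "(2 * V / \<omega>) powr (1 / N) \<le> \<rho>"
  shows "ennreal ((\<omega> / 2) powr (1 + \<sigma> / N) / 2 powr q * U powr (1 - \<sigma> / N))
    \<le> nonlocal_energy (q * (1 - \<sigma> / N)) (trunc_kernel \<sigma> \<rho>) v"
proof (cases "U = 0")
  case False
  with assms have "U > 0" by simp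
  let ?K = "(\<omega> / 2) powr (1 + \<sigma> / N) / 2 powr q"
  let ?E = "nonlocal_energy (q * (1 - \<sigma> / N)) (trunc_kernel \<sigma> \<rho>) v"
  have "ennreal (?K * U) = (\<integral>\<^sup>+x. ennreal (?K * \<bar>v x\<bar> powr q) \<partial>lborel)"
    using \<open>U > 0\<close> by (simp add: ennreal_mult nn_integral_cmult U del: times_divide_eq_left)
  also have "\<dots> \<le> (\<integral>\<^sup>+x. ennreal (U powr (\<sigma> / N)) * (\<integral>\<^sup>+y. ennreal (\<bar>v x - v y\<bar> powr
      (q * (1 - \<sigma> / N)) * trunc_kernel \<sigma> \<rho> (x - y)) \<partial>lborel) \<partial>lborel)"
    using Sobolev_pointwise[OF v assms(4) _ assms(6) \<open>U > 0\<close> assms(8) U V] assms(5) \<rho>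
    by (intro nn_integral_mono) (auto simp: N_def \<omega>_def)
  also have "\<dots> = ennreal (U powr (\<sigma> / N)) * ?E"
    unfolding nonlocal_energy_def by (intro nn_integral_cmult) measurable
  finally have *: "ennreal (?K * U) \<le> ennreal (U powr (\<sigma> / N)) * ?E" .
  have "ennreal (?K * U powr (1 - \<sigma> / N)) = ennreal (U powr - (\<sigma> / N)) * ennreal (?K * U)"
    using \<open>U > 0\<close> powr_add[of U 1 "- (\<sigma> / N)"] by (simp add: mult_ac flip: ennreal_mult)
  also have "\<dots> \<le> ennreal (U powr - (\<sigma> / N)) * (ennreal (U powr (\<sigma> / N)) * ?E)"
    by (intro mult_left_mono *) auto
  also have "\<dots> = ?E"
    using \<open>U > 0\<close> by (simp add: mult.assoc[symmetric] flip: ennreal_mult powr_add)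
  finally show ?thesis .
qed simp

lemma nonlocal_energy_mono:
  assumes "\<And>x y. \<bar>v x - v y\<bar> \<le> \<bar>w x - w y\<bar>" "\<And>z. 0 \<le> k z" "0 \<le> p"
  shows "nonlocal_energy p k v \<le> nonlocal_energy p k w"
  unfolding nonlocal_energy_def
  by (intro nn_integral_mono ennreal_leI mult_right_mono powr_mono2) (auto simp: assms)

text \<open>
  The functions \<open>w n\<close> with values cut off at height \<open>n\<close> have finite \<open>q\<close>-th power integral because their
  support has finite measure, and cutting off is 1-Lipschitz, so their energies are bounded by that
  of \<open>v\<close>.
\<close>

lemma Sobolev_trunc:
  fixes v :: "'a::euclidean_space \<Rightarrow> real" and \<sigma> \<rho> q e V :: real
  defines "N \<equiv> real DIM('a)" and "\<omega> \<equiv> unit_ball_vol (real DIM('a))"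
  assumes v [measurable]: "v \<in> borel_measurable borel"
    and "0 < \<sigma>" "\<sigma> < N" "0 < q" "0 \<le> e" "0 < V"
    and e: "nonlocal_energy (q * (1 - \<sigma> / N)) (trunc_kernel \<sigma> \<rho>) v = ennreal e"
    and V: "emeasure lborel {y. v y \<noteq> 0} \<le> ennreal V"
    and \<rho>: "(2 * V / \<omega>) powr (1 / N) \<le> \<rho>"
  shows "(\<integral>\<^sup>+y. ennreal (\<bar>v y\<bar> powr q) \<partial>lborel)
    \<le> ennreal ((2 powr q / (\<omega> / 2) powr (1 + \<sigma> / N) * e) powr (1 / (1 - \<sigma> / N)))"
proof -
  define \<theta> where "\<theta> = 1 - \<sigma> / N"
  define K where "K = (\<omega> / 2) powr (1 + \<sigma> / N) / 2 powr q"
  define w where "w n x = max (- real n) (min (real n) (v x))" for n x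
  have abs_w: "\<bar>w n x\<bar> = min (real n) \<bar>v x\<bar>" for n x by (auto simp: w_def)
  have w [measurable]: "w n \<in> borel_measurable borel" for n unfolding w_def by measurable
  have N: "N > 0" and \<omega>: "\<omega> > 0" by (simp_all add: N_def \<omega>_def)
  have \<theta>: "\<theta> > 0" using N assms by (simp add: \<theta>_def)
  have K: "K > 0" using \<omega> by (simp add: K_def)
  have bound: "(\<integral>\<^sup>+y. ennreal (\<bar>w n y\<bar> powr q) \<partial>lborel) \<le> ennreal ((e / K) powr (1 / \<theta>))" for n
  proof -
    have supp: "emeasure lborel {y. w n y \<noteq> 0} \<le> ennreal V"
      by (rule order_trans[OF emeasure_mono V]) (auto simp: w_def)
    have "(\<integral>\<^sup>+y. ennreal (\<bar>w n y\<bar> powr q) \<partial>lborel)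
        \<le> (\<integral>\<^sup>+y. ennreal (real n powr q) * indicator {y. w n y \<noteq> 0} y \<partial>lborel)"
    proof (intro nn_integral_mono)
      fix y
      have "\<bar>w n y\<bar> powr q \<le> real n powr q"
        using assms(6) by (intro powr_mono2) (auto simp: abs_w)
      then show "ennreal (\<bar>w n y\<bar> powr q) \<le> ennreal (real n powr q) * indicator {y. w n y \<noteq> 0} y"
        by (auto simp: indicator_def ennreal_leI)
    qed
    also have "\<dots> = ennreal (real n powr q) * emeasure lborel {y. w n y \<noteq> 0}"
      by (rule nn_integral_cmult_indicator) measurable
    also have "\<dots> < \<infinity>" using supp by (simp add: ennreal_mult_less_top le_less_trans[OF supp])
    finally obtain U where U: "(\<integral>\<^sup>+y. ennreal (\<bar>w n y\<bar> powr q) \<partial>lborel) = ennreal U" "0 \<le> U"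
      by (cases "\<integral>\<^sup>+y. ennreal (\<bar>w n y\<bar> powr q) \<partial>lborel") auto
    have "ennreal (K * U powr \<theta>) \<le> nonlocal_energy (q * (1 - \<sigma> / N)) (trunc_kernel \<sigma> \<rho>) (w n)"
      using Sobolev_trunc_if_finite[OF w assms(4) _ assms(6) U(2) assms(8) U(1) supp] assms(5) \<rho>
      by (auto simp: K_def \<theta>_def N_def \<omega>_def)
    also have "\<dots> \<le> nonlocal_energy (q * (1 - \<sigma> / N)) (trunc_kernel \<sigma> \<rho>) v"
      using assms(6) \<theta> by (intro nonlocal_energy_mono) (auto simp: w_def \<theta>_def)
    finally have "K * U powr \<theta> \<le> e" using assms(7) by (simp add: e)
    then have "U powr \<theta> \<le> e / K" using K by (simp add: field_simps)
    then have "(U powr \<theta>) powr (1 / \<theta>) \<le> (e / K) powr (1 / \<theta>)"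
      using \<theta> by (intro powr_mono2) auto
    then show ?thesis using \<theta> U by (simp add: powr_powr ennreal_leI)
  qed
  have "(SUP n. ennreal (\<bar>w n y\<bar> powr q)) = ennreal (\<bar>v y\<bar> powr q)" for y
  proof (rule antisym)
    show "(SUP n. ennreal (\<bar>w n y\<bar> powr q)) \<le> ennreal (\<bar>v y\<bar> powr q)"
      using assms(6) by (intro SUP_least ennreal_leI powr_mono2) (auto simp: abs_w)
    obtain n where "\<bar>v y\<bar> \<le> real n" using real_arch_simple by blast
    then have "\<bar>w n y\<bar> = \<bar>v y\<bar>" by (simp add: abs_w)
    then show "ennreal (\<bar>v y\<bar> powr q) \<le> (SUP n. ennreal (\<bar>w n y\<bar> powr q))"
      using SUP_upper[of n UNIV "\<lambda>n. ennreal (\<bar>w n y\<bar> powr q)"] by simp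
  qed
  then have "(\<integral>\<^sup>+y. ennreal (\<bar>v y\<bar> powr q) \<partial>lborel)
      = (\<integral>\<^sup>+y. (SUP n. ennreal (\<bar>w n y\<bar> powr q)) \<partial>lborel)" by simp
  also have "\<dots> = (SUP n. \<integral>\<^sup>+y. ennreal (\<bar>w n y\<bar> powr q) \<partial>lborel)"
  proof (rule nn_integral_monotone_convergence_SUP)
    have "\<bar>w i y\<bar> powr q \<le> \<bar>w j y\<bar> powr q" if "i \<le> j" for i j y
      using assms(6) that by (intro powr_mono2) (auto simp: abs_w)
    then show "incseq (\<lambda>n y. ennreal (\<bar>w n y\<bar> powr q))"
      by (intro incseq_def[THEN iffD2] allI impI le_funI ennreal_leI)
  qed simp
  also have "\<dots> \<le> ennreal ((e / K) powr (1 / \<theta>))"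
    by (intro SUP_least bound)
  finally show ?thesis by (simp add: K_def \<theta>_def mult_ac)
qed

section \<open>Changing the truncation radius\<close>

lemma nn_integral_lborel_shift:
  fixes f :: "'a::euclidean_space \<Rightarrow> ennreal"
  assumes [measurable]: "f \<in> borel_measurable borel"
  shows "(\<integral>\<^sup>+x. f (c + x) \<partial>lborel) = (\<integral>\<^sup>+x. f x \<partial>lborel)"
  by (subst (2) lborel_distr_plus[of c, symmetric]) (simp add: nn_integral_distr)

lemma nn_integral_lborel_double:
  fixes f :: "'a::euclidean_space \<Rightarrow> ennreal"
  assumes [measurable]: "f \<in> borel_measurable borel"
  shows "(\<integral>\<^sup>+x. f x \<partial>lborel) = ennreal (2 powr DIM('a)) * (\<integral>\<^sup>+x. f (2 *\<^sub>R x) \<partial>lborel)"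
  by (subst lborel_affine[of 2 0])
    (simp_all add: nn_integral_density nn_integral_distr nn_integral_cmult powr_realpow flip: ennreal_power)

text \<open>
  In this form the dependence on the kernel is separated from the differences of translates, which
  can then be compared for \<open>h\<close> and \<open>2 h\<close>.
\<close>

lemma nonlocal_energy_eq_translations:
  assumes [measurable]: "v \<in> borel_measurable borel" "k \<in> borel_measurable borel" and k: "\<And>z. 0 \<le> k z"
  shows "nonlocal_energy p k v =
    (\<integral>\<^sup>+h. ennreal (k h) * (\<integral>\<^sup>+y. ennreal (\<bar>v (y + h) - v y\<bar> powr p) \<partial>lborel) \<partial>lborel)"
proof -
  have "nonlocal_energy p k v = (\<integral>\<^sup>+y. \<integral>\<^sup>+x. ennreal (\<bar>v x - v y\<bar> powr p * k (x - y)) \<partial>lborel \<partial>lborel)"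
    unfolding nonlocal_energy_def by (rule lborel_pair.Fubini') measurable
  also have "\<dots> = (\<integral>\<^sup>+y. \<integral>\<^sup>+h. ennreal (\<bar>v (y + h) - v y\<bar> powr p * k h) \<partial>lborel \<partial>lborel)"
  proof (rule nn_integral_cong)
    fix y
    show "(\<integral>\<^sup>+x. ennreal (\<bar>v x - v y\<bar> powr p * k (x - y)) \<partial>lborel)
        = (\<integral>\<^sup>+h. ennreal (\<bar>v (y + h) - v y\<bar> powr p * k h) \<partial>lborel)"
      by (subst nn_integral_lborel_shift[of _ y, symmetric]) auto
  qed
  also have "\<dots> = (\<integral>\<^sup>+h. \<integral>\<^sup>+y. ennreal (k h) * ennreal (\<bar>v (y + h) - v y\<bar> powr p) \<partial>lborel \<partial>lborel)"
    using k by (subst lborel_pair.Fubini') (auto simp: ennreal_mult' mult.commute)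
  also have "\<dots> = (\<integral>\<^sup>+h. ennreal (k h) * (\<integral>\<^sup>+y. ennreal (\<bar>v (y + h) - v y\<bar> powr p) \<partial>lborel) \<partial>lborel)"
    by (intro nn_integral_cong nn_integral_cmult) measurable
  finally show ?thesis .
qed

lemma powr_abs_add_le:
  fixes a b p :: real
  assumes "0 \<le> p"
  shows "\<bar>a + b\<bar> powr p \<le> 2 powr p * (\<bar>a\<bar> powr p + \<bar>b\<bar> powr p)"
proof -
  have "\<bar>a + b\<bar> powr p \<le> (2 * max \<bar>a\<bar> \<bar>b\<bar>) powr p"
    using assms by (intro powr_mono2) auto
  also have "\<dots> \<le> 2 powr p * (\<bar>a\<bar> powr p + \<bar>b\<bar> powr p)"
    by (simp add: powr_mult max_def)
  finally show ?thesis .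
qed

text \<open>
  The difference over \<open>2 h\<close> telescopes into two differences over \<open>h\<close> with the same integral, by
  translation invariance.
\<close>

lemma translation_difference_double:
  fixes v :: "'a::euclidean_space \<Rightarrow> real"
  assumes [measurable]: "v \<in> borel_measurable borel" and "0 \<le> p"
  shows "(\<integral>\<^sup>+y. ennreal (\<bar>v (y + 2 *\<^sub>R h) - v y\<bar> powr p) \<partial>lborel)
    \<le> ennreal (2 * 2 powr p) * (\<integral>\<^sup>+y. ennreal (\<bar>v (y + h) - v y\<bar> powr p) \<partial>lborel)" (is "?L \<le> _ * ?R")
proof -
  let ?f = "\<lambda>y. ennreal (\<bar>v (y + h) - v y\<bar> powr p)"
  have "?L \<le> (\<integral>\<^sup>+y. ennreal (2 powr p) * (?f (h + y) + ?f y) \<partial>lborel)"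
  proof (intro nn_integral_mono)
    fix y
    show "ennreal (\<bar>v (y + 2 *\<^sub>R h) - v y\<bar> powr p) \<le> ennreal (2 powr p) * (?f (h + y) + ?f y)"
      using powr_abs_add_le[OF assms(2), of "v (h + y + h) - v (h + y)" "v (y + h) - v y"]
      by (simp add: scaleR_2 add_ac ennreal_leI flip: ennreal_plus ennreal_mult)
  qed
  also have "\<dots> = ennreal (2 powr p) * ((\<integral>\<^sup>+y. ?f (h + y) \<partial>lborel) + ?R)"
    by (subst nn_integral_cmult, measurable) (subst nn_integral_add, auto)
  also have "(\<integral>\<^sup>+y. ?f (h + y) \<partial>lborel) = ?R"
    by (rule nn_integral_lborel_shift) measurable
  also have "ennreal (2 powr p) * (?R + ?R) = ennreal (2 * 2 powr p) * ?R"
    by (simp add: ennreal_mult mult.assoc mult.left_commute[of 2] flip: mult_2)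
  finally show ?thesis .
qed

text \<open>
  Substituting \<open>2 h\<close> for \<open>h\<close> multiplies the volume by \<open>2 powr N\<close> and the kernel by
  \<open>2 powr -(N + \<sigma>)\<close>, so the only loss comes from the doubled translation.
\<close>

lemma trunc_energy_double:
  fixes v :: "'a::euclidean_space \<Rightarrow> real"
  assumes v [measurable]: "v \<in> borel_measurable borel" and "0 \<le> p" "0 \<le> \<sigma>"
  shows "nonlocal_energy p (trunc_kernel \<sigma> (2 * \<rho>)) v
    \<le> ennreal (2 * 2 powr p) * nonlocal_energy p (trunc_kernel \<sigma> \<rho>) v"
proof -
  let ?N = "real DIM('a)"
  let ?g = "\<lambda>h. \<integral>\<^sup>+y. ennreal (\<bar>v (y + h) - v y\<bar> powr p) \<partial>lborel"
  have kernel: "trunc_kernel \<sigma> (2 * \<rho>) (2 *\<^sub>R h) = 2 powr - (?N + \<sigma>) * trunc_kernel \<sigma> \<rho> h" for h :: 'a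
    by (simp add: trunc_kernel_def powr_mult)
  have "nonlocal_energy p (trunc_kernel \<sigma> (2 * \<rho>)) v
      = (\<integral>\<^sup>+h. ennreal (trunc_kernel \<sigma> (2 * \<rho>) h) * ?g h \<partial>lborel)"
    by (rule nonlocal_energy_eq_translations) auto
  also have "\<dots> = ennreal (2 powr ?N) *
      (\<integral>\<^sup>+h. ennreal (trunc_kernel \<sigma> (2 * \<rho>) (2 *\<^sub>R h)) * ?g (2 *\<^sub>R h) \<partial>lborel)"
    by (rule nn_integral_lborel_double) measurable
  also have "\<dots> \<le> ennreal (2 powr ?N) * (\<integral>\<^sup>+h. ennreal (2 powr - (?N + \<sigma>) * (2 * 2 powr p)) *
      (ennreal (trunc_kernel \<sigma> \<rho> h) * ?g h) \<partial>lborel)"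
  proof (intro mult_left_mono nn_integral_mono)
    fix h
    have "ennreal (trunc_kernel \<sigma> (2 * \<rho>) (2 *\<^sub>R h)) * ?g (2 *\<^sub>R h)
      \<le> ennreal (2 powr - (?N + \<sigma>) * trunc_kernel \<sigma> \<rho> h) * (ennreal (2 * 2 powr p) * ?g h)"
      unfolding kernel by (intro mult_left_mono translation_difference_double) (use assms in auto)
    then show "ennreal (trunc_kernel \<sigma> (2 * \<rho>) (2 *\<^sub>R h)) * ?g (2 *\<^sub>R h)
      \<le> ennreal (2 powr - (?N + \<sigma>) * (2 * 2 powr p)) * (ennreal (trunc_kernel \<sigma> \<rho> h) * ?g h)"
      by (simp add: ennreal_mult mult_ac)
  qed auto
  also have "\<dots> = ennreal (2 powr ?N * (2 powr - (?N + \<sigma>) * (2 * 2 powr p))) *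
      (\<integral>\<^sup>+h. ennreal (trunc_kernel \<sigma> \<rho> h) * ?g h \<partial>lborel)"
    by (subst nn_integral_cmult) (auto simp: ennreal_mult mult.assoc)
  also have "\<dots> = ennreal (2 powr - \<sigma> * (2 * 2 powr p)) * nonlocal_energy p (trunc_kernel \<sigma> \<rho>) v"
    by (subst nonlocal_energy_eq_translations) (auto simp: mult.assoc[symmetric] simp flip: powr_add)
  also have "\<dots> \<le> ennreal (2 * 2 powr p) * nonlocal_energy p (trunc_kernel \<sigma> \<rho>) v"
    using assms by (intro mult_right_mono ennreal_leI) (auto simp: powr_minus field_simps ge_one_powr_ge_zero)
  finally show ?thesis .
qed

lemma trunc_energy_power2:
  fixes v :: "'a::euclidean_space \<Rightarrow> real"
  assumes v: "v \<in> borel_measurable borel" and "0 \<le> p" "0 \<le> \<sigma>"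
  shows "nonlocal_energy p (trunc_kernel \<sigma> (2 ^ j * \<rho>)) v
    \<le> ennreal ((2 * 2 powr p) ^ j) * nonlocal_energy p (trunc_kernel \<sigma> \<rho>) v"
proof (induction j)
  case (Suc j)
  have "nonlocal_energy p (trunc_kernel \<sigma> (2 ^ Suc j * \<rho>)) v
      \<le> ennreal (2 * 2 powr p) * nonlocal_energy p (trunc_kernel \<sigma> (2 ^ j * \<rho>)) v"
    using trunc_energy_double[OF assms, of "2 ^ j * \<rho>"] by (simp add: mult.assoc)
  also have "\<dots> \<le> ennreal (2 * 2 powr p) *
      (ennreal ((2 * 2 powr p) ^ j) * nonlocal_energy p (trunc_kernel \<sigma> \<rho>) v)"
    by (intro mult_left_mono Suc) auto
  also have "\<dots> = ennreal ((2 * 2 powr p) ^ Suc j) * nonlocal_energy p (trunc_kernel \<sigma> \<rho>) v"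
    by (simp add: ennreal_mult mult.assoc)
  finally show ?case .
qed simp

section \<open>The logarithmic kernel and Lebesgue measurable functions\<close>

lemma kernel_const_pos:
  assumes "0 < s" "s < 1" "0 < p"
  shows "0 < kernel_const N s p"
  using assms by (auto simp: kernel_const_def intro!: divide_pos_pos mult_pos_pos Gamma_real_pos add_nonneg_pos)

lemma log_kernel_ge_trunc_kernel:
  assumes "0 < s" "s < 1" "0 < p"
  shows "kernel_const DIM('a) s p * trunc_kernel (s * p) (exp (- 1)) z
    \<le> log_kernel s p (z :: 'a::euclidean_space)"
proof (cases "z = 0 \<or> exp (- 1) \<le> norm z")
  case True
  then show ?thesis using kernel_const_pos[OF assms, of "DIM('a)"]
    by (auto simp: trunc_kernel_def log_kernel_def)
next
  case False
  then have "ln (norm z) < ln (exp (- 1))" by (subst ln_less_cancel_iff) auto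
  then have "1 \<le> max 0 (- ln (norm z))" by simp
  then have "1 * norm z powr - (real DIM('a) + s * p)
      \<le> max 0 (- ln (norm z)) * norm z powr - (real DIM('a) + s * p)"
    by (intro mult_right_mono) auto
  then have "norm z powr - (real DIM('a) + s * p)
      \<le> max 0 (- ln (norm z)) / norm z powr (real DIM('a) + s * p)"
    unfolding powr_minus by (simp add: divide_inverse)
  then have "kernel_const DIM('a) s p * norm z powr - (real DIM('a) + s * p)
      \<le> kernel_const DIM('a) s p * (max 0 (- ln (norm z)) / norm z powr (real DIM('a) + s * p))"
    using kernel_const_pos[OF assms, of "DIM('a)"] by (intro mult_left_mono) auto
  then show ?thesis using False by (simp add: trunc_kernel_def log_kernel_def)
qed

text \<open>
  Passing to a Borel representative turns the integral over the completed measure on the product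
  space into an iterated integral over \<open>lborel\<close>, to which Tonelli's theorem applies: two
  functions that agree off a null set \<open>Z\<close> have the same integrand off \<open>Z \<times> UNIV \<union> UNIV \<times> Z\<close>.
\<close>

lemma log_energy_eq_nonlocal_energy:
  fixes u v :: "'a::euclidean_space \<Rightarrow> real"
  assumes v [measurable]: "v \<in> borel_measurable borel" and uv: "AE x in lborel. u x = v x"
  shows "log_energy s p u = nonlocal_energy p (log_kernel s p) v"
proof -
  obtain Z where Z: "Z \<in> null_sets lborel" "{x. u x \<noteq> v x} \<subseteq> Z"
    using uv by (auto elim!: AE_E simp: null_sets_def)
  have [measurable]: "log_kernel s p \<in> borel_measurable (borel :: 'a measure)"
    unfolding log_kernel_def by measurable
  have "Z \<times> UNIV \<union> UNIV \<times> Z \<in> null_sets (lborel \<Otimes>\<^sub>M lborel)"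
    using Z(1) by (intro null_sets.Un lborel.times_in_null_sets1 lborel.times_in_null_sets2) auto
  then have ae: "AE (x, y) in lborel \<Otimes>\<^sub>M lborel. u x = v x \<and> u y = v y"
    using Z(2) by (auto elim!: eventually_mono[OF AE_not_in])
  have "log_energy s p u = (\<integral>\<^sup>+(x, y). ennreal (\<bar>u x - u y\<bar> powr p * log_kernel s p (x - y))
      \<partial>(lborel \<Otimes>\<^sub>M lborel))"
    by (simp add: log_energy_def nn_integral_completion lborel_prod)
  also have "\<dots> = (\<integral>\<^sup>+(x, y). ennreal (\<bar>v x - v y\<bar> powr p * log_kernel s p (x - y))
      \<partial>(lborel \<Otimes>\<^sub>M lborel))"
    using ae by (intro nn_integral_cong_AE) auto
  also have "\<dots> = nonlocal_energy p (log_kernel s p) v"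
    unfolding nonlocal_energy_def by (subst lborel.nn_integral_fst[symmetric]) auto
  finally show ?thesis .
qed

section \<open>The fractional Sobolev inequality for the logarithmic energy\<close>

theorem theorem3p2:
  fixes s p :: real and \<Omega> :: "'a::euclidean_space set"
  assumes "1 < p" and "0 < s" and "s < 1"
    and "real DIM('a) > s * p"
    and "bounded \<Omega>" and "open \<Omega>"
  shows "\<exists>C::real. C > 0 \<and>
    (\<forall>u \<in> W_log_0 s p \<Omega>.
       ennpowr (Lp_norm (real DIM('a) * p / (real DIM('a) - s * p)) \<Omega> u) p
         \<le> ennreal C * log_energy s p u)"
proof -
  define N \<omega> \<sigma> q where "N = real DIM('a)" and "\<omega> = unit_ball_vol (real DIM('a))"
    and "\<sigma> = s * p" and "q = N * p / (N - s * p)"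
  define \<kappa> where "\<kappa> = kernel_const DIM('a) s p"
  define K where "K = 2 powr q / (\<omega> / 2) powr (1 + \<sigma> / N)"
  \<comment> \<open>Adding 1 makes the bound on the support positive also for empty \<open>\<Omega>\<close>.\<close>
  define V where "V = measure lborel \<Omega> + 1"
  have \<sigma>: "0 < \<sigma>" "\<sigma> < N" using assms by (auto simp: \<sigma>_def N_def)
  have N: "0 < N" by (simp add: N_def)
  have q_eq: "q = N * p / (N - \<sigma>)" by (simp add: q_def \<sigma>_def)
  have q: "0 < q" using N \<sigma> assms(1) by (simp add: q_eq)
  have "1 - \<sigma> / N = (N - \<sigma>) / N" using N by (simp add: field_simps)
  then have exponent: "q * (1 - \<sigma> / N) = p" using N \<sigma> by (simp add: q_eq)
  then have "p / q = 1 - \<sigma> / N" using q by (auto simp: field_simps)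
  have \<kappa>: "0 < \<kappa>" using assms by (simp add: \<kappa>_def kernel_const_pos)
  have "0 < \<omega>" by (simp add: \<omega>_def)
  then have K: "0 < K" by (auto simp: K_def intro!: divide_pos_pos)
  have "0 < V" by (simp add: V_def add_nonneg_pos)
  \<comment> \<open>The number of doublings that brings the radius \<open>exp (-1)\<close> up to that of a ball of measure \<open>2 V\<close>.\<close>
  obtain j where "(2 * V / \<omega>) powr (1 / N) * exp 1 < 2 ^ j"
    using real_arch_pow[of 2] by force
  then have \<rho>: "(2 * V / \<omega>) powr (1 / N) \<le> 2 ^ j * exp (- 1)"
    by (simp add: exp_minus field_simps)
  define A where "A = (2 * 2 powr p) ^ j"
  have A: "A > 0" by (simp add: A_def)
  show ?thesis
  proof (intro exI conjI ballI)
    show "0 < K * (A / \<kappa>)" using K A \<kappa> by simp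
    fix u assume u: "u \<in> W_log_0 s p \<Omega>"
    then have "u \<in> borel_measurable (completion lborel)" by (simp add: W_log_0_def Lp_space_def)
    then obtain v where v [measurable]: "v \<in> borel_measurable borel" and uv: "AE x in lborel. u x = v x"
      using completion_ex_borel_measurable_real[of u lborel] by auto
    have supp: "AE x in lborel. x \<notin> \<Omega> \<longrightarrow> u x = 0"
      using u by (simp add: W_log_0_def AE_completion_iff)
    have \<Omega> [measurable]: "\<Omega> \<in> sets borel" using assms by auto
    have "emeasure lborel {y. v y \<noteq> 0} \<le> emeasure lborel \<Omega>"
      using uv supp by (intro emeasure_mono_AE) (auto elim!: eventually_elim2)
    also have "\<dots> \<le> ennreal V"
      using emeasure_bounded_finite[OF assms(5)]
      by (simp add: V_def emeasure_eq_ennreal_measure ennreal_leI)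
    finally have V: "emeasure lborel {y. v y \<noteq> 0} \<le> ennreal V" .
    have E: "log_energy s p u = nonlocal_energy p (log_kernel s p) v"
      by (rule log_energy_eq_nonlocal_energy[OF v uv])
    have "log_energy s p u < \<infinity>" using u by (simp add: W_log_0_def)
    then obtain e where e: "log_energy s p u = ennreal e" "0 \<le> e"
      by (auto simp: less_top_ennreal)
    have "ennreal \<kappa> * nonlocal_energy p (trunc_kernel \<sigma> (exp (- 1))) v \<le> ennreal e"
    proof -
      have "ennreal \<kappa> * nonlocal_energy p (trunc_kernel \<sigma> (exp (- 1))) v = (\<integral>\<^sup>+x. \<integral>\<^sup>+y. ennreal \<kappa> *
          ennreal (\<bar>v x - v y\<bar> powr p * trunc_kernel \<sigma> (exp (- 1)) (x - y)) \<partial>lborel \<partial>lborel)"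
        unfolding nonlocal_energy_def
        by (subst nn_integral_cmult[symmetric], measurable) (simp add: nn_integral_cmult)
      also have "\<dots> \<le> nonlocal_energy p (log_kernel s p) v"
        unfolding nonlocal_energy_def
      proof (intro nn_integral_mono)
        fix x y
        have "\<bar>v x - v y\<bar> powr p * (\<kappa> * trunc_kernel \<sigma> (exp (- 1)) (x - y))
            \<le> \<bar>v x - v y\<bar> powr p * log_kernel s p (x - y)"
          using assms unfolding \<kappa>_def \<sigma>_def
          by (intro mult_left_mono log_kernel_ge_trunc_kernel) auto
        then show "ennreal \<kappa> * ennreal (\<bar>v x - v y\<bar> powr p * trunc_kernel \<sigma> (exp (- 1)) (x - y))
            \<le> ennreal (\<bar>v x - v y\<bar> powr p * log_kernel s p (x - y))"
          using \<kappa> by (simp add: ennreal_leI mult_ac flip: ennreal_mult)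
      qed
      finally show ?thesis using E e by simp
    qed
    moreover have "nonlocal_energy p (trunc_kernel \<sigma> (2 ^ j * exp (- 1))) v
        \<le> ennreal A * nonlocal_energy p (trunc_kernel \<sigma> (exp (- 1))) v"
      unfolding A_def using assms \<sigma> by (intro trunc_energy_power2 v) auto
    ultimately have large: "ennreal \<kappa> * nonlocal_energy p (trunc_kernel \<sigma> (2 ^ j * exp (- 1))) v
        \<le> ennreal (A * e)" (is "_ * ?E \<le> _")
    proof -
      assume small: "ennreal \<kappa> * nonlocal_energy p (trunc_kernel \<sigma> (exp (- 1))) v \<le> ennreal e"
        and "?E \<le> ennreal A * nonlocal_energy p (trunc_kernel \<sigma> (exp (- 1))) v"
      then have "ennreal \<kappa> * ?E \<le> ennreal \<kappa> * (ennreal A * nonlocal_energy p (trunc_kernel \<sigma> (exp (- 1))) v)"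
        by (intro mult_left_mono) auto
      also have "\<dots> \<le> ennreal A * ennreal e"
        using small by (subst mult.left_commute) (intro mult_left_mono, auto)
      finally show ?thesis using A e(2) by (simp add: ennreal_mult)
    qed
    then have "?E < top"
      using \<kappa> by (cases "?E = top") (auto simp: ennreal_mult_top top_unique less_top)
    then obtain d where d: "?E = ennreal d" "0 \<le> d"
      by (auto simp: less_top_ennreal)
    have "d \<le> A / \<kappa> * e"
      using large d \<kappa> A e(2) by (simp add: field_simps flip: ennreal_mult)
    have "(\<integral>\<^sup>+y. ennreal (\<bar>v y\<bar> powr q) \<partial>lborel) \<le> ennreal ((K * d) powr (1 / (1 - \<sigma> / N)))"
      using Sobolev_trunc[OF v \<sigma>(1) _ q d(2) \<open>0 < V\<close> _ V] \<sigma> d(1) \<rho> exponent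
      by (simp add: K_def N_def \<omega>_def)
    moreover have "(\<integral>\<^sup>+x\<in>\<Omega>. ennreal (\<bar>u x\<bar> powr q) \<partial>lebesgue) \<le> (\<integral>\<^sup>+y. ennreal (\<bar>v y\<bar> powr q) \<partial>lborel)"
      unfolding nn_integral_completion
      using uv by (intro nn_integral_mono_AE) (auto simp: indicator_def elim!: eventually_mono)
    ultimately have "(\<integral>\<^sup>+x\<in>\<Omega>. ennreal (\<bar>u x\<bar> powr q) \<partial>lebesgue) \<le> ennreal ((K * d) powr (1 / (1 - \<sigma> / N)))"
      by (rule order_trans[rotated])
    then obtain U where U: "(\<integral>\<^sup>+x\<in>\<Omega>. ennreal (\<bar>u x\<bar> powr q) \<partial>lebesgue) = ennreal U" "0 \<le> U"
        "U \<le> (K * d) powr (1 / (1 - \<sigma> / N))"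
      by (cases "\<integral>\<^sup>+x\<in>\<Omega>. ennreal (\<bar>u x\<bar> powr q) \<partial>lebesgue") (auto simp: top_unique)
    have "ennpowr (Lp_norm q \<Omega> u) p = ennreal (U powr (1 - \<sigma> / N))"
      using U \<open>p / q = _\<close> by (simp add: Lp_norm_def ennpowr_def powr_powr)
    also have "U powr (1 - \<sigma> / N) \<le> ((K * d) powr (1 / (1 - \<sigma> / N))) powr (1 - \<sigma> / N)"
      using U \<sigma> by (intro powr_mono2) auto
    also have "\<dots> = K * d" using \<sigma> K d by (simp add: powr_powr)
    also have "K * d \<le> K * (A / \<kappa> * e)" using K \<open>d \<le> _\<close> by (intro mult_left_mono) auto
    also have "ennreal (K * (A / \<kappa> * e)) = ennreal (K * (A / \<kappa>)) * log_energy s p u"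
      using K A \<kappa> e by (simp add: mult.assoc flip: ennreal_mult)
    finally show "ennpowr (Lp_norm (real DIM('a) * p / (real DIM('a) - s * p)) \<Omega> u) p
        \<le> ennreal (K * (A / \<kappa>)) * log_energy s p u"
      by (simp add: q_def N_def ennreal_leI)
  qed
qed

end
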